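(* Let $\rho=(\tau_1,\dots,\tau_n)$ be a factorization in a symmetric group, i.e. a finite sequence of transpositions. Then its mind-body dual is $$\rho^{*}=\left(\tau_1,\ \tau_2^{\tau_1},\ \dots,\ \tau_n^{\tau_{n-1}\cdots\tau_1}\right),$$ that is, the $i$-th term of $\rho^*$ is $\tau_i^{\tau_{i-1}\cdots\tau_1}$ for $1\le i\le n$.
   Context: Permutations are multiplied from left to right (so $(1\,2)(2\,3)=(3\,2\,1)$), and $g^{h}:=h^{-1}gh$. A factorization in $\mathcal{S}_V$ ($V$ a finite set) is a finite sequence of transpositions of $V$; the number of its terms is denoted $n$ in this statement. Its associated e-graph has vertex set $V$ and, for each $i$, an edge labeled $i$ joining the two points moved by $\tau_i$; this is a bijection between factorizations of length $n$ in $\mathcal{S}_V$ and loopless graphs (multiple edges allowed) on $V$ with $n$ edges labeled bijectively by $\{1,\dots,n\}$ (e-graphs on $V$). For a vertex $v$ of an e-graph $\Gamma$ the minimally increasing greedy trail (migt) $\overrightarrow{v}$ starts at $v$ along the smallest-labeled edge at $v$; after arriving at a vertex $w$ along an edge $e$ it continues with the smallest-labeled edge at $w$ whose label is larger than that of $e$, and stops if there is none. If $v$ is isolated, $\overrightarrow{v}$ is the trivial trail. Every edge belongs to exactly two migts. The mind-body dual $\Gamma^*$ has vertices $v^*=\overrightarrow{v}$, $v\in V$, and for each $i$ an edge labeled $i$ joining the two migts that contain the edge of $\Gamma$ labeled $i$; identifying $v^*$ with $v$, $\Gamma^*$ is again an e-graph on $V$. The mind-body dual $\rho^*$ of a factorization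 $\rho$ is the factorization associated with the mind-body dual of the e-graph associated with $\rho$. *)

theory Defs
  imports "HOL-Combinatorics.Permutations"
begin

subsection \<open>Permutations, multiplied from left to right\<close>

definition perm_mult :: "('a \<Rightarrow> 'a) \<Rightarrow> ('a \<Rightarrow> 'a) \<Rightarrow> 'a \<Rightarrow> 'a"  (infixl "\<cdot>" 70)
  where "g \<cdot> h = h \<circ> g"

definition perm_prod :: "('a \<Rightarrow> 'a) list \<Rightarrow> 'a \<Rightarrow> 'a"
  where "perm_prod gs = foldr (\<cdot>) gs id"

definition perm_conj :: "('a \<Rightarrow> 'a) \<Rightarrow> ('a \<Rightarrow> 'a) \<Rightarrow> 'a \<Rightarrow> 'a"
  where "perm_conj g h = inv h \<cdot> g \<cdot> h"

definition transposition_on :: "'a set \<Rightarrow> ('a \<Rightarrow> 'a) \<Rightarrow> bool"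
  where "transposition_on V t \<longleftrightarrow> (\<exists>a\<in>V. \<exists>b\<in>V. a \<noteq> b \<and> t = transpose a b)"

definition moved :: "('a \<Rightarrow> 'a) \<Rightarrow> 'a set"
  where "moved t = {x. t x \<noteq> x}"

text \<open>The term with index \<open>i\<close> (counted from 1) of a factorization is the list entry
  at position \<open>i - 1\<close>.\<close>

definition factorization :: "'a set \<Rightarrow> ('a \<Rightarrow> 'a) list \<Rightarrow> bool"
  where "factorization V \<rho> \<longleftrightarrow> (\<forall>t \<in> set \<rho>. transposition_on V t)"


subsection \<open>E-graphs\<close>

text \<open>As the labelling of the edges by \<open>{1..n}\<close> is bijective, an edge is identified with its
  label, and the graph is given by the list of the endpoint sets: the edge labeled \<open>i\<close> sits at
  list position \<open>i - 1\<close>. Repeated entries are multiple edges.\<close>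

record 'a egraph =
  verts :: "'a set"
  edges :: "'a set list"

definition egraph :: "'a egraph \<Rightarrow> bool"
  where "egraph \<Gamma> \<longleftrightarrow> finite (verts \<Gamma>) \<and> (\<forall>e \<in> set (edges \<Gamma>). e \<subseteq> verts \<Gamma> \<and> card e = 2)"

definition ends :: "'a egraph \<Rightarrow> nat \<Rightarrow> 'a set"
  where "ends \<Gamma> i = edges \<Gamma> ! (i - 1)"

definition egraph_of :: "'a set \<Rightarrow> ('a \<Rightarrow> 'a) list \<Rightarrow> 'a egraph"
  where "egraph_of V \<rho> = \<lparr>verts = V, edges = map moved \<rho>\<rparr>"

text \<open>The inverse of the bijection \<open>egraph_of V\<close> (lemma \<open>bij_betw_egraph_of\<close> below).\<close>

definition factorization_of :: "'a egraph \<Rightarrow> ('a \<Rightarrow> 'a) list"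
  where "factorization_of \<Gamma> =
    (THE \<rho>. factorization (verts \<Gamma>) \<rho> \<and> egraph_of (verts \<Gamma>) \<rho> = \<Gamma>)"

lemma moved_transpose: "a \<noteq> b \<Longrightarrow> moved (transpose a b) = {a, b}"
  by (auto simp: moved_def transpose_def)

lemma inj_on_moved: "inj_on moved {t. transposition_on V t}"
proof (rule inj_onI, unfold mem_Collect_eq)
  fix s t assume s: "transposition_on V s" and t: "transposition_on V t" and eq: "moved s = moved t"
  from s obtain a b where ab: "a \<noteq> b" "s = transpose a b" by (auto simp: transposition_on_def)
  from t obtain c d where cd: "c \<noteq> d" "t = transpose c d" by (auto simp: transposition_on_def)
  have "{a, b} = {c, d}" using eq ab cd by (simp add: moved_transpose)
  then show "s = t" using ab cd by (auto simp: doubleton_eq_iff transpose_commute)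
qed

lemma moved_image: "moved ` {t. transposition_on V t} = {e. e \<subseteq> V \<and> card e = 2}"
proof (rule set_eqI, rule iffI)
  fix e assume "e \<in> moved ` {t. transposition_on V t}"
  then show "e \<in> {e. e \<subseteq> V \<and> card e = 2}" by (auto simp: transposition_on_def moved_transpose)
next
  fix e assume "e \<in> {e. e \<subseteq> V \<and> card e = 2}"
  then obtain a b where "e = {a, b}" "a \<noteq> b" "a \<in> V" "b \<in> V" by (auto simp: card_2_iff)
  then have "e = moved (transpose a b)" "transposition_on V (transpose a b)"
    by (auto simp: moved_transpose transposition_on_def)
  then show "e \<in> moved ` {t. transposition_on V t}" by blast
qed

lemma bij_betw_egraph_of:
  assumes "finite V"
  shows "bij_betw (egraph_of V) {\<rho>. factorization V \<rho> \<and> length \<rho> = n}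
           {\<Gamma>. egraph \<Gamma> \<and> verts \<Gamma> = V \<and> length (edges \<Gamma>) = n}"
proof -
  let ?T = "{t. transposition_on V t}"
  let ?L = "{\<rho>. factorization V \<rho> \<and> length \<rho> = n}"
  let ?G = "{\<Gamma> :: 'a egraph. egraph \<Gamma> \<and> verts \<Gamma> = V \<and> length (edges \<Gamma>) = n}"
  have "inj_on (egraph_of V) ?L"
  proof (rule inj_onI)
    fix \<rho> \<sigma> assume "\<rho> \<in> ?L" "\<sigma> \<in> ?L" "egraph_of V \<rho> = egraph_of V \<sigma>"
    then have "map moved \<rho> = map moved \<sigma>" "set \<rho> \<union> set \<sigma> \<subseteq> ?T"
      by (auto simp: egraph_of_def factorization_def)
    then show "\<rho> = \<sigma>" using inj_on_moved by (metis inj_on_subset map_inj_on)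
  qed
  moreover have "egraph_of V ` ?L \<subseteq> ?G"
    using assms moved_image[of V] by (fastforce simp: egraph_of_def egraph_def factorization_def)
  moreover have "\<Gamma> \<in> egraph_of V ` ?L" if \<Gamma>: "\<Gamma> \<in> ?G" for \<Gamma>
  proof -
    have "set (edges \<Gamma>) \<subseteq> moved ` ?T" using \<Gamma> by (auto simp: egraph_def moved_image)
    then have "edges \<Gamma> \<in> map moved ` lists ?T"
      unfolding lists_image[symmetric] by (auto simp: in_lists_conv_set)
    then obtain \<rho> where \<rho>: "edges \<Gamma> = map moved \<rho>" "\<rho> \<in> lists ?T" by blast
    then have "\<rho> \<in> ?L" "egraph_of V \<rho> = \<Gamma>"
      using \<Gamma> by (auto simp: factorization_def lists_eq_set egraph_of_def)
    then show ?thesis by blast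
  qed
  ultimately show ?thesis unfolding bij_betw_def by blast
qed

lemma factorization_of_egraph_of:
  assumes "factorization V \<rho>"
  shows "factorization_of (egraph_of V \<rho>) = \<rho>"
  unfolding factorization_of_def
proof (rule the_equality)
  show "factorization (verts (egraph_of V \<rho>)) \<rho> \<and>
      egraph_of (verts (egraph_of V \<rho>)) \<rho> = egraph_of V \<rho>"
    using assms by (simp add: egraph_of_def)
next
  fix \<sigma> assume "factorization (verts (egraph_of V \<rho>)) \<sigma> \<and>
      egraph_of (verts (egraph_of V \<rho>)) \<sigma> = egraph_of V \<rho>"
  then have "map moved \<sigma> = map moved \<rho>" "set \<sigma> \<union> set \<rho> \<subseteq> {t. transposition_on V t}"
    using assms by (auto simp: egraph_of_def factorization_def)
  then show "\<sigma> = \<rho>" using inj_on_moved by (metis inj_on_subset map_inj_on)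
qed


subsection \<open>Minimally increasing greedy trails and the mind-body dual\<close>

text \<open>A trail is its start vertex together with its successive steps; the step \<open>(i, u)\<close>
  traverses the edge labeled \<open>i\<close> and arrives at the vertex \<open>u\<close>.\<close>

type_synonym 'a trail = "'a \<times> (nat \<times> 'a) list"

definition contains_edge :: "'a trail \<Rightarrow> nat \<Rightarrow> bool"
  where "contains_edge T i \<longleftrightarrow> i \<in> fst ` set (snd T)"

definition later_labels :: "'a egraph \<Rightarrow> 'a \<Rightarrow> nat \<Rightarrow> nat set"
  where "later_labels \<Gamma> w k = {i \<in> {1..length (edges \<Gamma>)}. w \<in> ends \<Gamma> i \<and> k < i}"

text \<open>The second endpoint; meaningful when \<open>card e = 2\<close> and \<open>w \<in> e\<close>.\<close>

definition other_end :: "'a set \<Rightarrow> 'a \<Rightarrow> 'a"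
  where "other_end e w = the_elem (e - {w})"

text \<open>\<open>greedy_steps \<Gamma> w k\<close> is the continuation of a greedy trail from \<open>w\<close> that may use only
  labels larger than \<open>k\<close>.\<close>

function greedy_steps :: "'a egraph \<Rightarrow> 'a \<Rightarrow> nat \<Rightarrow> (nat \<times> 'a) list"
  where "greedy_steps \<Gamma> w k =
    (if later_labels \<Gamma> w k = {} then []
     else let i = Min (later_labels \<Gamma> w k); u = other_end (ends \<Gamma> i) w
          in (i, u) # greedy_steps \<Gamma> u i)"
  by pat_completeness auto
termination
proof (relation "measure (\<lambda>(\<Gamma>, w, k). length (edges \<Gamma>) - k)")
  fix \<Gamma> :: "'a egraph" and w k i u
  assume "later_labels \<Gamma> w k \<noteq> {}" "i = Min (later_labels \<Gamma> w k)"
  then have "i \<in> later_labels \<Gamma> w k" using Min_in[of "later_labels \<Gamma> w k"]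
    by (auto simp: later_labels_def)
  then show "((\<Gamma>, u, i), \<Gamma>, w, k) \<in> measure (\<lambda>(\<Gamma>, w, k). length (edges \<Gamma>) - k)"
    by (auto simp: later_labels_def)
qed simp

declare greedy_steps.simps [simp del]

text \<open>All labels are positive, so the bound \<open>0\<close> is no restriction on the first edge.\<close>

definition migt :: "'a egraph \<Rightarrow> 'a \<Rightarrow> 'a trail"
  where "migt \<Gamma> v = (v, greedy_steps \<Gamma> v 0)"

definition migts :: "'a egraph \<Rightarrow> 'a trail set"
  where "migts \<Gamma> = migt \<Gamma> ` verts \<Gamma>"

definition trail_dual :: "'a egraph \<Rightarrow> 'a trail egraph"
  where "trail_dual \<Gamma> =
    \<lparr>verts = migts \<Gamma>,
     edges = map (\<lambda>i. {T \<in> migts \<Gamma>. contains_edge T i}) [1..<length (edges \<Gamma>) + 1]\<rparr>"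

definition rename_verts :: "('a \<Rightarrow> 'b) \<Rightarrow> 'a egraph \<Rightarrow> 'b egraph"
  where "rename_verts f \<Gamma> = \<lparr>verts = f ` verts \<Gamma>, edges = map ((`) f) (edges \<Gamma>)\<rparr>"

text \<open>The identification of \<open>migt \<Gamma> v\<close> with \<open>v\<close> sends a trail to its start vertex; it is
  injective on the migts.\<close>

definition mind_body_dual :: "'a egraph \<Rightarrow> 'a egraph"
  where "mind_body_dual \<Gamma> = rename_verts fst (trail_dual \<Gamma>)"

definition dual_factorization :: "'a set \<Rightarrow> ('a \<Rightarrow> 'a) list \<Rightarrow> ('a \<Rightarrow> 'a) list"
  where "dual_factorization V \<rho> = factorization_of (mind_body_dual (egraph_of V \<rho>))"

end

theory Submission imports Defs begin

text \<open>
  The trails of an e-graph can be read as trajectories of one synchronous process. Put a token on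
  every vertex and go through the labels \<open>1, 2, \<dots>, n\<close>; at time \<open>i\<close> the tokens on the two ends
  of the edge labeled \<open>i\<close> change places. The token that started at \<open>v\<close> traverses the edge
  \<open>i\<close> exactly when it stands on one of its ends at time \<open>i\<close>, so it follows the greedy trail of
  \<open>v\<close> (\<open>greedy_steps_Cons\<close>). Just before time \<open>i\<close> this token stands on the image of \<open>v\<close>
  under \<open>\<tau>\<^sub>1 \<cdots> \<tau>\<^sub>i\<^sub>-\<^sub>1\<close>. Hence the trail of \<open>v\<close> contains the edge \<open>i\<close> iff that
  image is moved by \<open>\<tau>\<^sub>i\<close> (\<open>contains_edge_migt_iff\<close>), and the ends of the edge \<open>i\<close> of the
  dual are the preimages of the two points moved by \<open>\<tau>\<^sub>i\<close>.

  Taking these preimages means applying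
  \<open>h = (\<tau>\<^sub>1 \<cdots> \<tau>\<^sub>i\<^sub>-\<^sub>1)\<^sup>-\<^sup>1 = \<tau>\<^sub>i\<^sub>-\<^sub>1 \<cdots> \<tau>\<^sub>1\<close>, and
  the transposition of the points \<open>h a\<close> and \<open>h b\<close> is \<open>(a b)\<^sup>h\<close>. So the dual graph is the graph
  of the sequence of conjugates; as this sequence is a factorization, it is the dual factorization.
\<close>


lemma perm_prod_Nil [simp]: "perm_prod [] = id"
  by (simp add: perm_prod_def)

lemma perm_prod_Cons [simp]: "perm_prod (g # gs) = perm_prod gs \<circ> g"
  by (simp add: perm_prod_def perm_mult_def)

lemma perm_prod_append: "perm_prod (gs @ hs) = perm_prod hs \<circ> perm_prod gs"
  by (induction gs) (auto simp: comp_assoc)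

lemma perm_prod_permutes:
  assumes "\<And>g. g \<in> set gs \<Longrightarrow> g permutes V"
  shows "perm_prod gs permutes V"
  using assms by (induction gs) (auto intro: permutes_compose permutes_id)

lemma transposition_on_permutes: "transposition_on V t \<Longrightarrow> t permutes V"
  by (auto simp: transposition_on_def permutes_swap_id)

lemma moved_subset: "transposition_on V t \<Longrightarrow> moved t \<subseteq> V"
  by (auto simp: transposition_on_def moved_transpose)

lemma other_end_moved:
  assumes "transposition_on V t" and "w \<in> moved t"
  shows "other_end (moved t) w = t w"
proof -
  from assms(1) obtain a b where ab: "a \<noteq> b" "t = transpose a b"
    by (auto simp: transposition_on_def)
  then have "moved t - {w} = {t w}"
    using assms(2) by (auto simp: moved_transpose)
  then show ?thesis by (simp add: other_end_def)
qed

lemma factorization_nth: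
  "factorization V \<rho> \<Longrightarrow> k < length \<rho> \<Longrightarrow> transposition_on V (\<rho> ! k)"
  by (simp add: factorization_def)

text \<open>Transpositions are involutions, so reversing a product of them inverts it.\<close>

lemma perm_prod_rev_cancel:
  assumes "factorization V \<rho>"
  shows "perm_prod (rev \<rho>) (perm_prod \<rho> x) = x"
  using assms
proof (induction \<rho> arbitrary: x)
  case (Cons t ts)
  then have "perm_prod (rev ts) (perm_prod ts y) = y" for y
    by (simp add: factorization_def)
  moreover have "t (t x) = x"
    using Cons.prems by (auto simp: factorization_def transposition_on_def)
  ultimately show ?case by (simp add: perm_prod_append)
qed simp

lemma inv_perm_prod_rev:
  assumes "factorization V \<rho>"
  shows "inv (perm_prod (rev \<rho>)) = perm_prod \<rho>"
proof (rule inv_unique_comp)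
  have "factorization V (rev \<rho>)" using assms by (simp add: factorization_def)
  from perm_prod_rev_cancel[OF this] show "perm_prod \<rho> \<circ> perm_prod (rev \<rho>) = id"
    by (simp add: fun_eq_iff)
  from perm_prod_rev_cancel[OF assms] show "perm_prod (rev \<rho>) \<circ> perm_prod \<rho> = id"
    by (simp add: fun_eq_iff)
qed

lemma transposition_on_perm_conj:
  assumes "transposition_on V t" and "h permutes V"
  shows "transposition_on V (perm_conj t h)"
proof -
  obtain a b where ab: "a \<in> V" "b \<in> V" "a \<noteq> b" "t = transpose a b"
    using assms(1) by (auto simp: transposition_on_def)
  have "bij h" using assms(2) by (rule permutes_bij)
  then have "perm_conj t h = transpose (h a) (h b)"
    using ab by (auto simp: perm_conj_def perm_mult_def fun_eq_iff transpose_def bij_inv_eq_iff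
        bij_is_inj inv_f_f bij_is_surj surj_f_inv_f)
  moreover have "h a \<in> V" "h b \<in> V" using ab assms(2) by (auto simp: permutes_in_image)
  moreover have "h a \<noteq> h b" using ab \<open>bij h\<close> by (auto simp: bij_def dest: injD)
  ultimately show ?thesis by (auto simp: transposition_on_def)
qed

lemma moved_perm_conj:
  assumes "bij h"
  shows "moved (perm_conj t h) = {v. inv h v \<in> moved t}"
  using bij_inv_eq_iff[OF assms]
  by (auto simp: moved_def perm_conj_def perm_mult_def)


text \<open>A greedy trail waiting at \<open>w\<close> for a label larger than \<open>k\<close> takes the edge \<open>k + 1\<close>
  if \<open>w\<close> is one of its ends and otherwise goes on waiting at \<open>w\<close>. As \<open>t = \<rho> ! k\<close> fixes
  the points that it does not move, the trail is at \<open>t w\<close> afterwards in both cases.\<close>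

lemma greedy_steps_Cons:
  assumes "factorization V \<rho>" and "k < length \<rho>"
  defines "t \<equiv> \<rho> ! k"
  shows "greedy_steps (egraph_of V \<rho>) w k =
    (if w \<in> moved t then [(Suc k, t w)] else []) @ greedy_steps (egraph_of V \<rho>) (t w) (Suc k)"
proof -
  let ?\<Gamma> = "egraph_of V \<rho>"
  have ends: "ends ?\<Gamma> (Suc k) = moved t"
    using assms(2) by (simp add: ends_def egraph_of_def t_def)
  have len: "length (edges ?\<Gamma>) = length \<rho>" by (simp add: egraph_of_def)
  show ?thesis
  proof (cases "w \<in> moved t")
    case True
    then have "Suc k \<in> later_labels ?\<Gamma> w k"
      using ends len assms(2) by (simp add: later_labels_def)
    moreover have "Min (later_labels ?\<Gamma> w k) = Suc k"
      using calculation by (intro Min_eqI) (auto simp: later_labels_def)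
    moreover have "other_end (moved t) w = t w"
      using other_end_moved[OF factorization_nth[OF assms(1,2)]] True by (simp add: t_def)
    ultimately show ?thesis
      using True ends by (subst greedy_steps.simps) (auto simp: Let_def)
  next
    case False
    then have "later_labels ?\<Gamma> w k = later_labels ?\<Gamma> w (Suc k)"
      using ends by (auto simp: later_labels_def intro!: Suc_lessI)
    then have "greedy_steps ?\<Gamma> w k = greedy_steps ?\<Gamma> w (Suc k)"
      by (simp add: greedy_steps.simps[of _ w])
    moreover have "t w = w" using False by (simp add: moved_def)
    ultimately show ?thesis using False by simp
  qed
qed

text \<open>A trail that waits at \<open>w\<close> after the label \<open>k\<close> stands on the image of \<open>w\<close> under
  \<open>\<tau>\<^sub>k\<^sub>+\<^sub>1 \<cdots> \<tau>\<^sub>i\<^sub>-\<^sub>1\<close> when the label \<open>i\<close> comes up. The start \<open>k\<close> has to vary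
  because the recursion of \<^const>\<open>greedy_steps\<close> consumes the labels from the front.\<close>

lemma greedy_steps_label_iff:
  assumes "factorization V \<rho>" and "k \<le> length \<rho>"
  shows "i \<in> fst ` set (greedy_steps (egraph_of V \<rho>) w k) \<longleftrightarrow>
    k < i \<and> i \<le> length \<rho> \<and> perm_prod (drop k (take (i - 1) \<rho>)) w \<in> moved (\<rho> ! (i - 1))"
  using assms(2)
proof (induction k arbitrary: w rule: inc_induct)
  case base
  then show ?case
    by (subst greedy_steps.simps) (auto simp: later_labels_def egraph_of_def)
next
  case (step k)
  let ?labels = "\<lambda>w k. fst ` set (greedy_steps (egraph_of V \<rho>) w k)"
  have first_step: "i \<in> ?labels w k \<longleftrightarrow>
      w \<in> moved (\<rho> ! k) \<and> i = Suc k \<or> i \<in> ?labels ((\<rho> ! k) w) (Suc k)"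
    using step.hyps by (subst greedy_steps_Cons[OF assms(1)]) (auto simp: image_Un)
  show ?case
  proof (cases "Suc k < i \<and> i \<le> length \<rho>")
    case True
    then have "drop k (take (i - 1) \<rho>) = \<rho> ! k # drop (Suc k) (take (i - 1) \<rho>)"
      using step.hyps by (subst Cons_nth_drop_Suc[symmetric]) auto
    then show ?thesis
      unfolding first_step step.IH using True by auto
  next
    case False
    then consider "i = Suc k" | "i \<le> k" | "length \<rho> < i" by linarith
    then show ?thesis
      unfolding first_step step.IH using step.hyps by cases auto
  qed
qed

lemma contains_edge_migt_iff:
  assumes "factorization V \<rho>" and "1 \<le> i" "i \<le> length \<rho>"
  shows "contains_edge (migt (egraph_of V \<rho>) v) i \<longleftrightarrow>
    perm_prod (take (i - 1) \<rho>) v \<in> moved (\<rho> ! (i - 1))"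
  using greedy_steps_label_iff[OF assms(1), of 0 i v] assms(2,3)
  by (simp add: contains_edge_def migt_def)

text \<open>Since every trail carries its start vertex as first component, renaming trails to vertices
  turns the ends of a dual edge into the set of those \<open>v\<close> whose trail contains the edge.\<close>

lemma mind_body_dual_eq:
  "mind_body_dual \<Gamma> =
    \<lparr>verts = verts \<Gamma>,
     edges = map (\<lambda>i. {v \<in> verts \<Gamma>. contains_edge (migt \<Gamma> v) i}) [1..<length (edges \<Gamma>) + 1]\<rparr>"
proof -
  have fst_migt: "fst (migt \<Gamma> v) = v" for v by (simp add: migt_def)
  have "fst ` migts \<Gamma> = verts \<Gamma>"
    by (simp add: migts_def image_image fst_migt)
  moreover have "fst ` {T \<in> migts \<Gamma>. contains_edge T i} =
      {v \<in> verts \<Gamma>. contains_edge (migt \<Gamma> v) i}" for i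
    by (force simp: migts_def fst_migt)
  ultimately show ?thesis
    by (simp add: mind_body_dual_def rename_verts_def trail_dual_def)
qed

theorem theorem2p22:
  fixes V :: "'a set" and \<rho> :: "('a \<Rightarrow> 'a) list"
  assumes "finite V" and "factorization V \<rho>"
  shows "dual_factorization V \<rho> =
    map (\<lambda>i. perm_conj (\<rho> ! (i - 1)) (perm_prod (rev (take (i - 1) \<rho>)))) [1..<length \<rho> + 1]"
proof -
  define \<sigma> where "\<sigma> i = perm_conj (\<rho> ! (i - 1)) (perm_prod (rev (take (i - 1) \<rho>)))" for i
  let ?I = "[1..<length \<rho> + 1]"
  have prefix: "factorization V (take j \<rho>)" for j
    using assms(2) by (auto simp: factorization_def dest: in_set_takeD)
  have perm: "perm_prod (rev (take j \<rho>)) permutes V" for j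
    using prefix[of j]
    by (intro perm_prod_permutes) (auto simp: factorization_def intro: transposition_on_permutes)
  have transp: "transposition_on V (\<sigma> i)" if "i \<in> set ?I" for i
    unfolding \<sigma>_def using that
    by (intro transposition_on_perm_conj perm factorization_nth[OF assms(2)]) auto
  have dual_edge: "{v \<in> V. contains_edge (migt (egraph_of V \<rho>) v) i} = moved (\<sigma> i)"
    if i: "i \<in> set ?I" for i
  proof -
    have "moved (\<sigma> i) = {v. perm_prod (take (i - 1) \<rho>) v \<in> moved (\<rho> ! (i - 1))}"
      unfolding \<sigma>_def
      by (simp add: moved_perm_conj[OF permutes_bij[OF perm]] inv_perm_prod_rev[OF prefix])
    then show ?thesis
      using i contains_edge_migt_iff[OF assms(2), of i] moved_subset[OF transp[OF i]] by auto
  qed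
  have "mind_body_dual (egraph_of V \<rho>) = egraph_of V (map \<sigma> ?I)"
    using dual_edge by (simp add: mind_body_dual_eq egraph_of_def)
  moreover have "factorization V (map \<sigma> ?I)"
    using transp by (auto simp: factorization_def)
  ultimately have "dual_factorization V \<rho> = map \<sigma> ?I"
    by (simp add: dual_factorization_def factorization_of_egraph_of)
  then show ?thesis by (simp add: \<sigma>_def[abs_def])
qed

end
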